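(* Let $\mathcal{T}(n,k)$ denote the number of staircase tableaux of size $n$ without any label $\gamma$ and with exactly $k$ labels $\alpha$ or $\delta$ on the diagonal. Then for all integers $n\ge1$ and all $k\in\mathbb{Z}$, $$\mathcal{T}(n,k)=(k+1)\,\mathcal{T}(n-1,k)+(n+1)\,\mathcal{T}(n-1,k-1)+(n-k+1)\,\mathcal{T}(n-1,k-2).$$
   Context: A staircase tableau of size $n$ is a Ferrers diagram of shape $(n,n-1,\dots,2,1)$ (English convention) whose boxes are either empty or labeled with one of $\alpha,\beta,\gamma,\delta$, such that: no box along the diagonal (the last box of each row) is empty; all boxes in the same row and to the left of a $\beta$ or a $\delta$ are empty; all boxes in the same column and above an $\alpha$ or a $\gamma$ are empty. For $n=0$ there is exactly one (empty) tableau, so $\mathcal{T}(0,0)=1$ and $\mathcal{T}(0,k)=0$ for $k\ne0$; also $\mathcal{T}(n,k)=0$ for $k<0$ or $k>n$. *)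

theory Defs
  imports Main
begin

datatype label = Alpha | Beta | Gamma | Delta

text \<open>
  Boxes are pairs (row, column), counted from 1 with row 1 on top and column 1 on the left;
  row \<open>i\<close> of the shape \<open>(n, n - 1, \<dots>, 1)\<close> has length \<open>n + 1 - i\<close>.
\<close>

definition boxes :: "nat \<Rightarrow> (nat \<times> nat) set" where
  "boxes n = {(i, j). 1 \<le> i \<and> i \<le> n \<and> 1 \<le> j \<and> j \<le> n + 1 - i}"

definition diagonal :: "nat \<Rightarrow> (nat \<times> nat) set" where
  "diagonal n = {(i, j). 1 \<le> i \<and> i \<le> n \<and> j = n + 1 - i}"

text \<open>
  A filling maps each box to its label, \<open>None\<close> meaning empty. It is required to be \<open>None\<close> outside
  the shape, so that distinct fillings are distinct functions and can be counted by \<open>card\<close>.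
\<close>

type_synonym filling = "nat \<times> nat \<Rightarrow> label option"

definition staircase_tableau :: "nat \<Rightarrow> filling \<Rightarrow> bool" where
  "staircase_tableau n t \<longleftrightarrow>
     (\<forall>b. b \<notin> boxes n \<longrightarrow> t b = None) \<and>
     (\<forall>b \<in> diagonal n. t b \<noteq> None) \<and>
     (\<forall>i j j'. (i, j) \<in> boxes n \<and> (i, j') \<in> boxes n \<and> j' < j \<and>
        t (i, j) \<in> {Some Beta, Some Delta} \<longrightarrow> t (i, j') = None) \<and>
     (\<forall>i i' j. (i, j) \<in> boxes n \<and> (i', j) \<in> boxes n \<and> i' < i \<and>
        t (i, j) \<in> {Some Alpha, Some Gamma} \<longrightarrow> t (i', j) = None)"

definition num_tableaux :: "nat \<Rightarrow> int \<Rightarrow> nat" where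
  "num_tableaux n k =
     card {t. staircase_tableau n t \<and>
              (\<forall>b \<in> boxes n. t b \<noteq> Some Gamma) \<and>
              int (card {b \<in> diagonal n. t b \<in> {Some Alpha, Some Delta}}) = k}"

end

theory Submission
  imports Defs
begin

text \<open>
  The recurrence is the case \<open>z = 1\<close> of a recurrence for a refined count, which is deduced from
  another one with a direct combinatorial meaning. Call a row free if it contains neither
  \<open>\<beta>\<close> nor \<open>\<delta>\<close>, and let \<open>F n z\<close> be the generating polynomial, in a variable \<open>x\<close>, of the tableaux
  of size \<open>n\<close> without \<open>\<gamma>\<close>, where each tableau has weight \<open>x\<close> to the number of \<open>\<alpha>\<close> and \<open>\<delta>\<close> on the
  diagonal times \<open>z\<close> to the number of free rows. The coefficients of \<open>F n z\<close> are
  \<open>weighted_count n k z\<close>, and \<open>z = 1\<close> gives the numbers of the theorem.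

  Removing the first column of a tableau of size \<open>n + 1\<close> leaves a tableau of size \<open>n\<close>
  (\<open>bij_betw_add_column\<close>). Conversely, in a new first column only the boxes in free rows and the
  new bottom box may be filled, and what is allowed there depends only on their order. Summing
  over all such columns (\<open>sum_columns\<close>, \<open>sum_first_columns\<close>) gives
  \[ 2 F (n + 1) z = (1 + x) (z + 2) F n (z + 2) - (1 - x) z F n z, \]
  which is \<open>weighted_count_Suc\<close>. Write this as \<open>F (n + 1) = L (F n)\<close>.

  The second recurrence, \<open>weighted_count_rec\<close>, does not shift \<open>z\<close>; it says \<open>F (n + 1) = M n (F n)\<close> with
  \[ M n G = (1 + (n + 1 + z) x + n x^2) G + (x - x^3) \frac{dG}{dx}. \]
  It holds for \<open>n = 0\<close>, and it propagates because \<open>L (M n G) = M (n + 1) (L G)\<close> for every \<open>G\<close>: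
  then \<open>F (n + 2) = L (M n (F n)) = M (n + 1) (F (n + 1))\<close>. Since \<open>L\<close> replaces \<open>z\<close> by \<open>z + 2\<close>,
  the induction needs all \<open>z\<close> at once even though only \<open>z = 1\<close> matters in the end.
\<close>


section \<open>Columns\<close>

text \<open>
  A tableau constrains a column added on its left only through the set \<open>A\<close> of rows in which that
  column may have a label, so columns can be counted apart from tableaux.
\<close>

definition columns :: "nat set \<Rightarrow> (nat \<Rightarrow> label option) set" where
  "columns A = {c. (\<forall>i. i \<notin> A \<longrightarrow> c i = None) \<and> (\<forall>i. c i \<noteq> Some Gamma) \<and>
                   (\<forall>i i'. i' < i \<and> c i = Some Alpha \<longrightarrow> c i' = None)}"

definition free_entries :: "nat set \<Rightarrow> (nat \<Rightarrow> label option) \<Rightarrow> nat set" where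
  "free_entries A c = {i \<in> A. c i \<notin> {Some Beta, Some Delta}}"

lemma finite_columns:
  assumes "finite A"
  shows "finite (columns A)"
proof (rule finite_subset)
  let ?L = "{None, Some Alpha, Some Beta, Some Gamma, Some Delta}"
  have "v \<in> ?L" for v
    by (cases v; cases "the v") auto
  then show "columns A \<subseteq> {c. \<forall>i. (i \<in> A \<longrightarrow> c i \<in> ?L) \<and> (i \<notin> A \<longrightarrow> c i = None)}"
    unfolding columns_def by blast
  show "finite {c. \<forall>i. (i \<in> A \<longrightarrow> c i \<in> ?L) \<and> (i \<notin> A \<longrightarrow> c i = None)}"
    using assms by (intro finite_set_of_finite_funs) auto
qed

text \<open>
  Columns are built by adding boxes at the bottom. An \<open>\<alpha>\<close> there empties everything above; any other
  entry imposes nothing on the rest of the column.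
\<close>

lemma columns_insert:
  assumes "\<forall>a\<in>A. a < m"
  shows "columns (insert m A) =
    insert [m \<mapsto> Alpha]
      ((\<lambda>(l, c). c(m := l)) ` ({None, Some Beta, Some Delta} \<times> columns A))"
    (is "?L = insert ?e (?f ` (?V \<times> _))")
proof (intro equalityI subsetI)
  fix c assume c: "c \<in> ?L"
  show "c \<in> insert ?e (?f ` (?V \<times> columns A))"
  proof (cases "c m = Some Alpha")
    case True
    have "c i = ?e i" for i
    proof (cases i m rule: linorder_cases)
      case less
      then show ?thesis using c True by (auto simp: columns_def)
    next
      case equal
      then show ?thesis using True by simp
    next
      case greater
      then have "i \<notin> insert m A" using assms by auto
      then show ?thesis using c by (auto simp: columns_def)
    qed
    then show ?thesis by auto
  next
    case False
    have "c m \<noteq> Some Gamma" using c by (simp add: columns_def)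
    with False have "c m \<in> ?V"
      by (cases "c m"; cases "the (c m)") auto
    moreover have "c(m := None) \<in> columns A"
      using c by (auto simp: columns_def)
    moreover have "c = ?f (c m, c(m := None))" by simp
    ultimately show ?thesis by blast
  qed
next
  fix c assume "c \<in> insert ?e (?f ` (?V \<times> columns A))"
  then consider "c = ?e" | l c' where "c = c'(m := l)" "l \<in> ?V" "c' \<in> columns A"
    by auto
  then show "c \<in> ?L"
  proof cases
    case 1
    then show ?thesis by (auto simp: columns_def)
  next
    case 2
    have "m \<notin> A" using assms by blast
    moreover have "\<not> m < i" if "c' i = Some Alpha" for i
      using that 2 assms by (cases "i \<in> A") (auto simp: columns_def)
    ultimately show ?thesis using 2 unfolding columns_def by (auto split: if_splits)
  qed
qed

lemma sum_columns_insert: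
  fixes g :: "(nat \<Rightarrow> label option) \<Rightarrow> int"
  assumes "finite A" and less: "\<forall>a\<in>A. a < m"
  shows "(\<Sum>c\<in>columns (insert m A). g c) = g [m \<mapsto> Alpha]
    + (\<Sum>c\<in>columns A. g (c(m := None)) + g (c(m := Some Beta)) + g (c(m := Some Delta)))"
proof -
  let ?V = "{None, Some Beta, Some Delta}"
  let ?f = "\<lambda>(l, c). c(m := l) :: nat \<Rightarrow> label option"
  have m: "c m = None" if "c \<in> columns A" for c
    using that less by (auto simp: columns_def)
  have inj: "inj_on ?f (?V \<times> columns A)"
  proof (rule inj_onI, clarify)
    fix l c l' c'
    assume c: "c \<in> columns A" "c' \<in> columns A" and eq: "c(m := l) = c'(m := l')"
    from eq have l: "l = l'" by (metis fun_upd_same)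
    have "c = c(m := l, m := None)" using m[OF c(1)] by (simp add: fun_upd_idem)
    also have "\<dots> = c'(m := l', m := None)" by (simp only: eq)
    also have "\<dots> = c'" using m[OF c(2)] by (simp add: fun_upd_idem)
    finally show "l = l' \<and> c = c'" using l by blast
  qed
  have fin: "finite (?f ` (?V \<times> columns A))"
    by (intro finite_imageI finite_cartesian_product finite_columns assms(1)) simp
  have notin: "[m \<mapsto> Alpha] \<notin> ?f ` (?V \<times> columns A)"
  proof
    assume "[m \<mapsto> Alpha] \<in> ?f ` (?V \<times> columns A)"
    then obtain l c where "l \<in> ?V" "[m \<mapsto> Alpha] = c(m := l)" by auto
    moreover from this(2) have "l = Some Alpha" by (metis fun_upd_same)
    ultimately show False by simp
  qed
  have "(\<Sum>c\<in>columns (insert m A). g c)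
      = g [m \<mapsto> Alpha] + (\<Sum>c\<in>?f ` (?V \<times> columns A). g c)"
    unfolding columns_insert[OF less] by (rule sum.insert[OF fin notin])
  also have "(\<Sum>c\<in>?f ` (?V \<times> columns A). g c) = (\<Sum>(l, c)\<in>?V \<times> columns A. g (c(m := l)))"
    by (subst sum.reindex[OF inj]) (simp add: case_prod_unfold comp_def)
  also have "\<dots> = (\<Sum>l\<in>?V. \<Sum>c\<in>columns A. g (c(m := l)))"
    by (rule sum.cartesian_product[symmetric])
  also have "\<dots> = (\<Sum>c\<in>columns A. g (c(m := None)) + g (c(m := Some Beta)) + g (c(m := Some Delta)))"
    by (simp add: sum.distrib)
  finally show ?thesis .
qed

lemma card_free_entries_insert:
  assumes "finite A" "m \<notin> A"
  shows "card (free_entries (insert m A) (c(m := l))) =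
    (if l \<in> {Some Beta, Some Delta} then 0 else 1) + card (free_entries A c)"
proof -
  have "free_entries (insert m A) (c(m := l)) =
      (if l \<in> {Some Beta, Some Delta} then {} else {m}) \<union> free_entries A c"
    using assms unfolding free_entries_def by (auto split: if_splits)
  moreover have "finite (free_entries A c)" "m \<notin> free_entries A c"
    using assms unfolding free_entries_def by auto
  ultimately show ?thesis by auto
qed

lemma free_entries_empty [simp]: "free_entries A Map.empty = A"
  by (simp add: free_entries_def)

text \<open>
  If \<open>S r\<close> is the sum for \<open>r\<close> available rows, splitting off the bottom row gives
  \<open>S (r + 1) = (z + 2) S r + z^(r + 1)\<close>: an empty box keeps its row free, \<open>\<beta>\<close> and \<open>\<delta>\<close> do not, and
  with \<open>\<alpha>\<close> as bottom entry all \<open>r + 1\<close> rows stay free. The factor 2 clears the denominator in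
  the solution of this recurrence.
\<close>

lemma sum_columns:
  fixes z :: int
  assumes "finite A"
  shows "2 * (\<Sum>c\<in>columns A. z ^ card (free_entries A c))
    = (z + 2) * (z + 2) ^ card A - z * z ^ card A"
  using assms
proof (induction A rule: finite_linorder_max_induct)
  case empty
  have "columns {} = {Map.empty}" by (auto simp: columns_def)
  then show ?case by simp
next
  case (insert m A)
  then have m: "m \<notin> A" by blast
  note upd = card_free_entries_insert[OF insert.hyps(1) m]
  let ?S = "\<Sum>c\<in>columns A. z ^ card (free_entries A c)"
  have "(\<Sum>c\<in>columns (insert m A). z ^ card (free_entries (insert m A) c))
      = z ^ Suc (card A) + (\<Sum>c\<in>columns A. (z + 2) * z ^ card (free_entries A c))"
    by (subst sum_columns_insert[OF insert.hyps])
       (simp_all add: upd algebra_simps)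
  then have "2 * (\<Sum>c\<in>columns (insert m A). z ^ card (free_entries (insert m A) c))
      = 2 * z ^ Suc (card A) + (z + 2) * (2 * ?S)"
    by (simp add: sum_distrib_left algebra_simps)
  then show ?case
    using insert.IH insert.hyps(1) m by (simp add: algebra_simps)
qed


section \<open>Removing the first column of a tableau\<close>

definition tableaux :: "nat \<Rightarrow> filling set" where
  "tableaux n = {t. staircase_tableau n t \<and> (\<forall>b \<in> boxes n. t b \<noteq> Some Gamma)}"

definition diag_count :: "nat \<Rightarrow> filling \<Rightarrow> nat" where
  "diag_count n t = card {b \<in> diagonal n. t b \<in> {Some Alpha, Some Delta}}"

text \<open>
  In a tableau these are the rows that may have a label in a column added on the left.
\<close>

definition free_rows :: "nat \<Rightarrow> filling \<Rightarrow> nat set" where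
  "free_rows n t = {i \<in> {1..n}. \<forall>j. t (i, j) \<notin> {Some Beta, Some Delta}}"

text \<open>
  Column 0 lies outside every shape, hence the separate value there.
\<close>

definition add_column :: "(nat \<Rightarrow> label option) \<Rightarrow> filling \<Rightarrow> filling" where
  "add_column c t = (\<lambda>(i, j). if j = 0 then None else if j = 1 then c i else t (i, j - 1))"

lemma add_column_simps [simp]:
  "add_column c t (i, 0) = None"
  "add_column c t (i, Suc 0) = c i"
  "add_column c t (i, Suc (Suc j)) = t (i, Suc j)"
  by (simp_all add: add_column_def)

text \<open>
  As labels occur only inside the shape, the row and column conditions need not mention the boxes,
  and in the absence of \<open>\<gamma>\<close> the column condition concerns \<open>\<alpha>\<close> only.
\<close>

lemma tableaux_iff:
  "t \<in> tableaux n \<longleftrightarrow>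
     (\<forall>i j. i = 0 \<or> j = 0 \<or> n + 1 < i + j \<longrightarrow> t (i, j) = None) \<and>
     (\<forall>i j. t (i, j) \<noteq> Some Gamma) \<and>
     (\<forall>i j. 0 < i \<and> 0 < j \<and> i + j = n + 1 \<longrightarrow> t (i, j) \<noteq> None) \<and>
     (\<forall>i j j'. j' < j \<and> t (i, j) \<in> {Some Beta, Some Delta} \<longrightarrow> t (i, j') = None) \<and>
     (\<forall>i i' j. i' < i \<and> t (i, j) = Some Alpha \<longrightarrow> t (i', j) = None)"
    (is "_ \<longleftrightarrow> ?out \<and> ?gamma \<and> ?diag \<and> ?row \<and> ?col")
proof -
  have box: "(i, j) \<in> boxes n \<longleftrightarrow> \<not> (i = 0 \<or> j = 0 \<or> n + 1 < i + j)" for i j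
    by (auto simp: boxes_def)
  have diag: "(i, j) \<in> diagonal n \<longleftrightarrow> 0 < i \<and> 0 < j \<and> i + j = n + 1" for i j
    by (auto simp: diagonal_def)
  show ?thesis
  proof
    assume "t \<in> tableaux n"
    then have out: "\<And>b. b \<notin> boxes n \<Longrightarrow> t b = None"
      and gamma: "\<And>b. b \<in> boxes n \<Longrightarrow> t b \<noteq> Some Gamma"
      and diag': "\<And>b. b \<in> diagonal n \<Longrightarrow> t b \<noteq> None"
      and row: "\<And>i j j'. (i, j) \<in> boxes n \<Longrightarrow> (i, j') \<in> boxes n \<Longrightarrow> j' < j \<Longrightarrow>
        t (i, j) \<in> {Some Beta, Some Delta} \<Longrightarrow> t (i, j') = None"
      and col: "\<And>i i' j. (i, j) \<in> boxes n \<Longrightarrow> (i', j) \<in> boxes n \<Longrightarrow> i' < i \<Longrightarrow>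
        t (i, j) \<in> {Some Alpha, Some Gamma} \<Longrightarrow> t (i', j) = None"
      unfolding tableaux_def staircase_tableau_def mem_Collect_eq by metis+
    show "?out \<and> ?gamma \<and> ?diag \<and> ?row \<and> ?col"
    proof (intro conjI allI impI)
      fix i j assume "i = 0 \<or> j = 0 \<or> n + 1 < i + j"
      then show "t (i, j) = None" using out[of "(i, j)"] box[of i j] by simp
    next
      fix i j show "t (i, j) \<noteq> Some Gamma"
        using gamma[of "(i, j)"] out[of "(i, j)"] by (cases "(i, j) \<in> boxes n") auto
    next
      fix i j assume "0 < i \<and> 0 < j \<and> i + j = n + 1"
      then show "t (i, j) \<noteq> None" using diag'[of "(i, j)"] diag[of i j] by simp
    next
      fix i j j' assume "j' < j \<and> t (i, j) \<in> {Some Beta, Some Delta}"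
      then show "t (i, j') = None"
        using row[of i j j'] out[of "(i, j)"] out[of "(i, j')"]
        by (cases "(i, j) \<in> boxes n"; cases "(i, j') \<in> boxes n") auto
    next
      fix i i' j assume "i' < i \<and> t (i, j) = Some Alpha"
      then show "t (i', j) = None"
        using col[of i j i'] out[of "(i, j)"] out[of "(i', j)"]
        by (cases "(i, j) \<in> boxes n"; cases "(i', j) \<in> boxes n") auto
    qed
  next
    assume t: "?out \<and> ?gamma \<and> ?diag \<and> ?row \<and> ?col"
    note out = t[THEN conjunct1] and t = t[THEN conjunct2]
    note gamma = t[THEN conjunct1] and t = t[THEN conjunct2]
    note diag' = t[THEN conjunct1] and t = t[THEN conjunct2]
    note row = t[THEN conjunct1] and col = t[THEN conjunct2]
    show "t \<in> tableaux n"
      unfolding tableaux_def staircase_tableau_def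
    proof (intro CollectI conjI ballI allI impI)
      fix b assume "b \<notin> boxes n"
      then show "t b = None" using out box[of "fst b" "snd b"] by (cases b) auto
    next
      fix b assume "b \<in> diagonal n"
      then show "t b \<noteq> None" using diag' diag[of "fst b" "snd b"] by (cases b) simp
    next
      fix b show "t b \<noteq> Some Gamma" using gamma by (cases b) simp
    next
      fix i j j'
      assume "(i, j) \<in> boxes n \<and> (i, j') \<in> boxes n \<and> j' < j \<and> t (i, j) \<in> {Some Beta, Some Delta}"
      then show "t (i, j') = None" using row by blast
    next
      fix i i' j
      assume "(i, j) \<in> boxes n \<and> (i', j) \<in> boxes n \<and> i' < i \<and> t (i, j) \<in> {Some Alpha, Some Gamma}"
      moreover from this have "t (i, j) = Some Alpha" using gamma by auto
      ultimately show "t (i', j) = None" using col by blast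
    qed
  qed
qed

lemma tableaux_outside:
  assumes "t \<in> tableaux n" "i = 0 \<or> j = 0 \<or> n + 1 < i + j"
  shows "t (i, j) = None"
  by (fact assms(1)[unfolded tableaux_iff, THEN conjunct1, THEN spec, THEN spec, THEN mp, OF assms(2)])

text \<open>
  A box of the new column must be empty if its row has a \<open>\<beta>\<close> or \<open>\<delta>\<close> further right, that is, unless
  its row is free. The bottom row \<open>n + 1\<close> is new and consists of one diagonal box; the old diagonal
  boxes stay on the diagonal when they move one step to the right.
\<close>

lemma add_column_in_tableaux_iff:
  assumes t0: "\<And>i. t (i, 0) = None"
  shows "add_column c t \<in> tableaux (Suc n) \<longleftrightarrow>
    t \<in> tableaux n \<and> c \<in> columns (insert (Suc n) (free_rows n t)) \<and> c (Suc n) \<noteq> None"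
    (is "?s \<in> _ \<longleftrightarrow> _ \<and> c \<in> columns ?A \<and> _")
proof
  assume s: "?s \<in> tableaux (Suc n)"
  then have out: "\<And>i j. i = 0 \<or> j = 0 \<or> Suc n + 1 < i + j \<Longrightarrow> ?s (i, j) = None"
    and gamma: "\<And>i j. ?s (i, j) \<noteq> Some Gamma"
    and diag: "\<And>i j. 0 < i \<Longrightarrow> 0 < j \<Longrightarrow> i + j = Suc n + 1 \<Longrightarrow> ?s (i, j) \<noteq> None"
    and row: "\<And>i j j'. j' < j \<Longrightarrow> ?s (i, j) \<in> {Some Beta, Some Delta} \<Longrightarrow> ?s (i, j') = None"
    and col: "\<And>i i' j. i' < i \<Longrightarrow> ?s (i, j) = Some Alpha \<Longrightarrow> ?s (i', j) = None"
    unfolding tableaux_iff by metis+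
  have shift: "?s (i, Suc j) = t (i, j)" if "0 < j" for i j
    using that by (cases j) simp_all
  have "t \<in> tableaux n"
    unfolding tableaux_iff
  proof (intro conjI allI impI)
    fix i j assume "i = 0 \<or> j = 0 \<or> n + 1 < i + j"
    then show "t (i, j) = None"
      using out[of i "Suc j"] shift[of j i] t0 by (cases "j = 0") auto
  next
    fix i j show "t (i, j) \<noteq> Some Gamma"
      using gamma[of i "Suc j"] shift[of j i] t0 by (cases "j = 0") auto
  next
    fix i j assume "0 < i \<and> 0 < j \<and> i + j = n + 1"
    then show "t (i, j) \<noteq> None" using diag[of i "Suc j"] shift[of j i] by auto
  next
    fix i j j' assume "j' < j \<and> t (i, j) \<in> {Some Beta, Some Delta}"
    then show "t (i, j') = None"
      using row[of "Suc j'" "Suc j" i] shift[of j i] shift[of j' i] t0 by (cases "j' = 0") auto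
  next
    fix i i' j assume "i' < i \<and> t (i, j) = Some Alpha"
    then show "t (i', j) = None"
      using col[of i' i "Suc j"] shift[of j] t0 by (cases "j = 0") auto
  qed
  moreover have "c \<in> columns ?A"
    unfolding columns_def
  proof (intro CollectI conjI allI impI)
    fix i assume "i \<notin> ?A"
    then consider "i = 0 \<or> Suc n < i" | j where "t (i, j) \<in> {Some Beta, Some Delta}"
      by (auto simp: free_rows_def not_less_eq_eq)
    then show "c i = None"
    proof cases
      case 1
      then show ?thesis using out[of i "Suc 0"] by auto
    next
      case (2 j)
      then have "0 < j" using t0 by (cases j) auto
      then show ?thesis using 2 row[of "Suc 0" "Suc j" i] shift[of j i] by auto
    qed
  next
    fix i show "c i \<noteq> Some Gamma" using gamma[of i "Suc 0"] by simp
  next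
    fix i i' assume "i' < i \<and> c i = Some Alpha"
    then show "c i' = None" using col[of i' i "Suc 0"] by simp
  qed
  moreover have "c (Suc n) \<noteq> None" using diag[of "Suc n" "Suc 0"] by simp
  ultimately show "t \<in> tableaux n \<and> c \<in> columns ?A \<and> c (Suc n) \<noteq> None" by blast
next
  assume "t \<in> tableaux n \<and> c \<in> columns ?A \<and> c (Suc n) \<noteq> None"
  then have out: "\<And>i j. i = 0 \<or> j = 0 \<or> n + 1 < i + j \<Longrightarrow> t (i, j) = None"
    and gamma: "\<And>i j. t (i, j) \<noteq> Some Gamma"
    and diag: "\<And>i j. 0 < i \<Longrightarrow> 0 < j \<Longrightarrow> i + j = n + 1 \<Longrightarrow> t (i, j) \<noteq> None"
    and row: "\<And>i j j'. j' < j \<Longrightarrow> t (i, j) \<in> {Some Beta, Some Delta} \<Longrightarrow> t (i, j') = None"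
    and col: "\<And>i i' j. i' < i \<Longrightarrow> t (i, j) = Some Alpha \<Longrightarrow> t (i', j) = None"
    and c_out: "\<And>i. i \<notin> ?A \<Longrightarrow> c i = None"
    and c_gamma: "\<And>i. c i \<noteq> Some Gamma"
    and c_col: "\<And>i i'. i' < i \<Longrightarrow> c i = Some Alpha \<Longrightarrow> c i' = None"
    and c_diag: "c (Suc n) \<noteq> None"
    unfolding tableaux_iff columns_def mem_Collect_eq by metis+
  have split: "j = 0 \<or> j = Suc 0 \<or> (\<exists>k. j = Suc (Suc k))" for j :: nat
    by presburger
  show "?s \<in> tableaux (Suc n)"
    unfolding tableaux_iff
  proof (intro conjI allI impI)
    fix i j assume "i = 0 \<or> j = 0 \<or> Suc n + 1 < i + j"
    moreover have "c i = None" if "i = 0 \<or> Suc n < i"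
      using c_out[of i] that by (auto simp: free_rows_def)
    ultimately show "?s (i, j) = None"
      using split[of j] out by auto
  next
    fix i j show "?s (i, j) \<noteq> Some Gamma"
      using split[of j] gamma c_gamma by auto
  next
    fix i j assume "0 < i \<and> 0 < j \<and> i + j = Suc n + 1"
    then show "?s (i, j) \<noteq> None"
      using split[of j] diag c_diag by auto
  next
    fix i j j' assume *: "j' < j \<and> ?s (i, j) \<in> {Some Beta, Some Delta}"
    show "?s (i, j') = None"
    proof (cases "j' = 0")
      case False
      with * obtain k where k: "j = Suc (Suc k)" using split[of j] by auto
      with * have lab: "t (i, Suc k) \<in> {Some Beta, Some Delta}" by simp
      then have "i \<le> n" using out[of i "Suc k"] by (cases "i \<le> n") auto
      then have "c i = None"
        using lab c_out[of i] by (auto simp: free_rows_def)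
      then show ?thesis
        using split[of j'] * k row[OF _ lab] by auto
    qed simp
  next
    fix i i' j assume "i' < i \<and> ?s (i, j) = Some Alpha"
    then show "?s (i', j) = None"
      using split[of j] col[of i' i] c_col[of i' i] by auto
  qed
qed

lemma ex_add_column:
  assumes "t \<in> tableaux (Suc n)"
  shows "\<exists>c t'. t = add_column c t' \<and> (\<forall>i. t' (i, 0) = None)"
proof -
  have *: "t (i, 0) = None" for i using assms by (rule tableaux_outside) simp
  let ?t' = "\<lambda>(i, j). if j = 0 then None else t (i, Suc j)"
  have "add_column (\<lambda>i. t (i, 1)) ?t' b = t b" for b
    using * by (cases b) (auto simp: add_column_def)
  then have "t = add_column (\<lambda>i. t (i, 1)) ?t'" by (intro ext) (rule sym)
  moreover have "\<forall>i. ?t' (i, 0) = None" by simp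
  ultimately show ?thesis by (intro exI conjI)
qed

lemma free_rows_add_column:
  assumes "t \<in> tableaux n"
  shows "free_rows (Suc n) (add_column c t) = free_entries (insert (Suc n) (free_rows n t)) c"
proof -
  let ?V = "{Some Beta, Some Delta}"
  have t: "t (i, j) = None" if "j = 0 \<or> Suc n < i + j" for i j
    using assms by (rule tableaux_outside) (use that in auto)
  have "(\<forall>j. add_column c t (i, j) \<notin> ?V) \<longleftrightarrow> c i \<notin> ?V \<and> (\<forall>j. t (i, j) \<notin> ?V)" (is "?l \<longleftrightarrow> ?r") for i
  proof
    assume l: ?l
    have "t (i, j) \<notin> ?V" for j
      using l[rule_format, of "Suc j"] t[of j i] by (cases j) simp_all
    then show ?r using l[rule_format, of "Suc 0"] by simp
  next
    assume ?r
    then show ?l by (simp add: add_column_def)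
  qed
  moreover have "t (Suc n, j) = None" for j
    using t[of j "Suc n"] by (cases j) auto
  ultimately show ?thesis
    unfolding free_rows_def free_entries_def
    by (auto simp: le_Suc_eq)
qed

lemma diag_count_add_column:
  "diag_count (Suc n) (add_column c t) =
    (if c (Suc n) \<in> {Some Alpha, Some Delta} then 1 else 0) + diag_count n t"
proof -
  let ?V = "{Some Alpha, Some Delta}"
  let ?D = "{b \<in> diagonal n. t b \<in> ?V}"
  let ?shift = "\<lambda>(i, j). (i, Suc j) :: nat \<times> nat"
  have diag: "diagonal (Suc n) = insert (Suc n, 1) (?shift ` diagonal n)"
    by (force simp: diagonal_def image_iff)
  have shift: "add_column c t (?shift b) = t b" if "b \<in> diagonal n" for b
    using that by (auto simp: diagonal_def add_column_def)
  have "{b \<in> diagonal (Suc n). add_column c t b \<in> ?V} =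
      (if c (Suc n) \<in> ?V then {(Suc n, 1)} else {}) \<union> ?shift ` ?D"
    unfolding diag using shift by auto
  moreover have "finite (diagonal n)"
    by (rule finite_subset[of _ "{..n} \<times> {..n}"]) (auto simp: diagonal_def)
  moreover have "(Suc n, 1) \<notin> ?shift ` ?D" by (auto simp: diagonal_def)
  moreover have "card (?shift ` ?D) = card ?D"
    by (rule card_image) (auto simp: inj_on_def)
  ultimately show ?thesis
    unfolding diag_count_def by simp
qed

abbreviation first_columns :: "nat \<Rightarrow> filling \<Rightarrow> (nat \<Rightarrow> label option) set" where
  "first_columns n t \<equiv> {c \<in> columns (insert (Suc n) (free_rows n t)). c (Suc n) \<noteq> None}"

lemma bij_betw_add_column:
  "bij_betw (\<lambda>(t, c). add_column c t) (SIGMA t:tableaux n. first_columns n t) (tableaux (Suc n))"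
proof (rule bij_betw_imageI)
  show "inj_on (\<lambda>(t, c). add_column c t) (SIGMA t:tableaux n. first_columns n t)"
  proof (rule inj_onI, clarify)
    fix t c t' c'
    assume t: "t \<in> tableaux n" "t' \<in> tableaux n" and eq: "add_column c t = add_column c' t'"
    have "c i = c' i" for i
      using fun_cong[OF eq, of "(i, Suc 0)"] by simp
    moreover have "t (i, j) = t' (i, j)" for i j
      using t[THEN tableaux_outside] fun_cong[OF eq, of "(i, Suc j)"] by (cases j) simp_all
    ultimately show "t = t' \<and> c = c'" by (auto simp: fun_eq_iff)
  qed
  have "t \<in> (\<lambda>(t, c). add_column c t) ` (SIGMA t:tableaux n. first_columns n t)"
    if t: "t \<in> tableaux (Suc n)" for t
  proof -
    obtain c t' where t': "t = add_column c t'" "\<And>i. t' (i, 0) = None"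
      using ex_add_column[OF t] by blast
    then have "(t', c) \<in> (SIGMA t:tableaux n. first_columns n t)"
      using t add_column_in_tableaux_iff[of t' c n] by simp
    then show ?thesis using t'(1) by (intro image_eqI[of _ _ "(t', c)"]) simp_all
  qed
  moreover have "add_column c t \<in> tableaux (Suc n)"
    if "t \<in> tableaux n" "c \<in> first_columns n t" for t c
    using that tableaux_outside[OF that(1)] by (subst add_column_in_tableaux_iff) auto
  ultimately show "(\<lambda>(t, c). add_column c t) ` (SIGMA t:tableaux n. first_columns n t)
      = tableaux (Suc n)"
    by auto
qed

lemma finite_free_rows [simp]: "finite (free_rows n t)"
  by (simp add: free_rows_def)

lemma tableaux_0: "tableaux 0 = {Map.empty}"
proof
  show "tableaux 0 \<subseteq> {Map.empty}"
  proof
    fix t assume t: "t \<in> tableaux 0"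
    have "t (i, j) = None" for i j
      using t by (rule tableaux_outside) auto
    then show "t \<in> {Map.empty}" by (auto simp: fun_eq_iff)
  qed
qed (auto simp: tableaux_iff)

lemma finite_tableaux: "finite (tableaux n)"
proof (induction n)
  case (Suc n)
  then show ?case
    using bij_betw_finite[OF bij_betw_add_column[of n]]
    by (simp add: finite_columns)
qed (simp add: tableaux_0)


section \<open>Recurrences for the weighted count\<close>

definition weighted_count :: "nat \<Rightarrow> int \<Rightarrow> int \<Rightarrow> int" where
  "weighted_count n k z =
    (\<Sum>t\<in>tableaux n. if int (diag_count n t) = k then z ^ card (free_rows n t) else 0)"

lemma num_tableaux_eq: "int (num_tableaux n k) = weighted_count n k 1"
proof -
  have "weighted_count n k 1 = (\<Sum>t\<in>{t \<in> tableaux n. int (diag_count n t) = k}. 1)"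
    unfolding weighted_count_def power_one by (rule sum.inter_filter[symmetric, OF finite_tableaux])
  then show ?thesis
    unfolding num_tableaux_def tableaux_def diag_count_def by (simp add: conj_assoc)
qed

lemma weighted_count_0: "weighted_count 0 k z = (if k = 0 then 1 else 0)"
  by (simp add: weighted_count_def tableaux_0 diag_count_def diagonal_def free_rows_def)

text \<open>
  With \<open>r\<close> free rows in \<open>t\<close> and \<open>S\<close> the sum of \<open>sum_columns\<close>, the bottom entries \<open>\<alpha>\<close>, \<open>\<beta>\<close> and \<open>\<delta>\<close>
  contribute \<open>x z^(r + 1)\<close>, \<open>S\<close> and \<open>x S\<close>, where \<open>x\<close> records the new diagonal box being \<open>\<alpha>\<close> or \<open>\<delta>\<close>.
\<close>

lemma sum_first_columns:
  fixes z :: int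
  shows "2 * (\<Sum>c\<in>first_columns n t. if int (diag_count (Suc n) (add_column c t)) = k
       then z ^ card (free_entries (insert (Suc n) (free_rows n t)) c) else 0) =
     (z + 2) * ((if int (diag_count n t) = k then (z + 2) ^ card (free_rows n t) else 0)
       + (if int (diag_count n t) = k - 1 then (z + 2) ^ card (free_rows n t) else 0))
     - z * ((if int (diag_count n t) = k then z ^ card (free_rows n t) else 0)
       - (if int (diag_count n t) = k - 1 then z ^ card (free_rows n t) else 0))"
proof -
  let ?A = "free_rows n t"
  let ?d = "int (diag_count n t)"
  have m: "Suc n \<notin> ?A" and less: "\<forall>a\<in>?A. a < Suc n"
    by (auto simp: free_rows_def)
  note upd = card_free_entries_insert[OF finite_free_rows m]
  let ?S = "\<Sum>c\<in>columns ?A. z ^ card (free_entries ?A c)"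
  let ?g = "\<lambda>c. if int (diag_count (Suc n) (add_column c t)) = k
       then z ^ card (free_entries (insert (Suc n) ?A) c) else 0"
  have "(\<Sum>c\<in>first_columns n t. ?g c) =
    (\<Sum>c\<in>columns (insert (Suc n) ?A). if c (Suc n) \<noteq> None then ?g c else 0)"
    by (rule sum.inter_filter) (simp add: finite_columns)
  also have "\<dots> = (if ?d = k - 1 then z * z ^ card ?A else 0) +
      (\<Sum>c\<in>columns ?A. (if ?d = k then z ^ card (free_entries ?A c) else 0) +
        (if ?d = k - 1 then z ^ card (free_entries ?A c) else 0))"
    unfolding sum_columns_insert[OF finite_free_rows less]
    by (cases "?d = k"; cases "1 + ?d = k") (auto simp: upd diag_count_add_column)
  also have "\<dots> = (if ?d = k - 1 then z * z ^ card ?A else 0) +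
      ((if ?d = k then ?S else 0) + (if ?d = k - 1 then ?S else 0))"
    by simp
  finally show ?thesis
    using sum_columns[OF finite_free_rows, of z n t] by (simp add: algebra_simps)
qed

lemma weighted_count_Suc:
  "2 * weighted_count (Suc n) k z =
    (z + 2) * (weighted_count n k (z + 2) + weighted_count n (k - 1) (z + 2))
    - z * (weighted_count n k z - weighted_count n (k - 1) z)"
proof -
  have "weighted_count (Suc n) k z =
    (\<Sum>(t, c)\<in>(SIGMA t:tableaux n. first_columns n t).
      if int (diag_count (Suc n) (add_column c t)) = k
      then z ^ card (free_rows (Suc n) (add_column c t)) else 0)"
    unfolding weighted_count_def
    by (subst sum.reindex_bij_betw[OF bij_betw_add_column, symmetric])
       (rule sum.cong[OF refl], clarsimp)
  also have "\<dots> = (\<Sum>t\<in>tableaux n. \<Sum>c\<in>first_columns n t.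
      if int (diag_count (Suc n) (add_column c t)) = k
      then z ^ card (free_entries (insert (Suc n) (free_rows n t)) c) else 0)"
    by (subst sum.Sigma[symmetric])
       (simp_all add: finite_tableaux finite_columns free_rows_add_column cong: if_cong)
  finally have "2 * weighted_count (Suc n) k z = (\<Sum>t\<in>tableaux n. 2 * (\<Sum>c\<in>first_columns n t.
      if int (diag_count (Suc n) (add_column c t)) = k
      then z ^ card (free_entries (insert (Suc n) (free_rows n t)) c) else 0))"
    by (simp only: sum_distrib_left)
  then show ?thesis
    unfolding sum_first_columns
    by (simp only: weighted_count_def sum_distrib_left[symmetric] sum.distrib sum_subtractf)
qed

text \<open>
  The induction step is the commutation \<open>L (M n G) = M (n + 1) (L G)\<close>, read off coefficientwise:
  expanding \<open>F (n + 2)\<close> by \<open>L\<close> and then by the induction hypothesis, and expanding the claimed right-hand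
  side by \<open>L\<close>, both give the same linear combination of the coefficients \<open>a\<close> of \<open>F n z\<close> and \<open>b\<close> of
  \<open>F n (z + 2)\<close>.
\<close>

lemma weighted_count_rec:
  "weighted_count (Suc n) k z = (k + 1) * weighted_count n k z
     + (int n + 1 + z) * weighted_count n (k - 1) z
     + (int n + 2 - k) * weighted_count n (k - 2) z"
proof (induction n arbitrary: k z)
  case 0
  show ?case using weighted_count_Suc[of 0 k z] by (auto simp: weighted_count_0)
next
  case (Suc n)
  define a where "a j = weighted_count n (k - j) z" for j
  define b where "b j = weighted_count n (k - j) (z + 2)" for j
  define N where "N = int n"
  have IH: "weighted_count (Suc n) (k - j) z =
      (k - j + 1) * a j + (N + 1 + z) * a (j + 1) + (N + 2 - (k - j)) * a (j + 2)"
    and IH2: "weighted_count (Suc n) (k - j) (z + 2) =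
      (k - j + 1) * b j + (N + 3 + z) * b (j + 1) + (N + 2 - (k - j)) * b (j + 2)" for j
    using Suc.IH[of "k - j" z] Suc.IH[of "k - j" "z + 2"]
    by (simp_all add: a_def b_def N_def diff_diff_eq add.assoc)
  have step: "2 * weighted_count (Suc n) (k - j) z =
      (z + 2) * (b j + b (j + 1)) - z * (a j - a (j + 1))" for j
    using weighted_count_Suc[of n "k - j" z] by (simp add: a_def b_def diff_diff_eq)
  have "2 * weighted_count (Suc (Suc n)) k z =
      (z + 2) * (weighted_count (Suc n) (k - 0) (z + 2) + weighted_count (Suc n) (k - 1) (z + 2))
      - z * (weighted_count (Suc n) (k - 0) z - weighted_count (Suc n) (k - 1) z)"
    using weighted_count_Suc[of "Suc n" k z] by simp
  also have "\<dots> = (k + 1) * ((z + 2) * (b 0 + b 1) - z * (a 0 - a 1))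
      + (N + 2 + z) * ((z + 2) * (b 1 + b 2) - z * (a 1 - a 2))
      + (N + 3 - k) * ((z + 2) * (b 2 + b 3) - z * (a 2 - a 3))"
    unfolding IH IH2 by simp algebra
  also have "\<dots> = (k + 1) * (2 * weighted_count (Suc n) k z)
      + (N + 2 + z) * (2 * weighted_count (Suc n) (k - 1) z)
      + (N + 3 - k) * (2 * weighted_count (Suc n) (k - 2) z)"
    using step[of 0] step[of 1] step[of 2] by simp
  finally show ?case by (simp add: N_def algebra_simps)
qed


section \<open>The recurrence for the number of tableaux\<close>

theorem mainTheorem5:
  fixes n :: nat and k :: int
  assumes "n \<ge> 1"
  shows "int (num_tableaux n k) =
           (k + 1) * int (num_tableaux (n - 1) k)
           + (int n + 1) * int (num_tableaux (n - 1) (k - 1))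
           + (int n - k + 1) * int (num_tableaux (n - 1) (k - 2))"
proof -
  obtain m where "n = Suc m" using assms by (cases n) auto
  then show ?thesis
    by (simp add: num_tableaux_eq weighted_count_rec algebra_simps)
qed

end
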